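(* Let $R$ be a commutative ring with $R=2R$, and let $I$ be an ideal of $R$. Let $P$ be a free $R$-module of rank $2n$, $n\ge1$, with the symplectic form given (w.r.t. a basis) by the standard alternating matrix $\psi_n$, and let $Q=R^2\oplus P$ (so the induced form on $Q$ has matrix $\psi_1\perp\psi_n=\psi_{n+1}$). Then, as groups of $(2n+2)\times(2n+2)$ matrices, $$\mathrm{ETrans}_{\mathrm{Sp}}(Q,IQ,\langle\,,\rangle_{\psi_{n+1}})=\mathrm{ESp}_{2n+2}(R,I).$$
   Context: $\psi_n=\sum_{i=1}^n e_{2i-1,2i}-\sum_{i=1}^n e_{2i,2i-1}$; the form given by a matrix $\varphi$ is $\langle p,q\rangle_\varphi=p\varphi q^t$ on row vectors; matrices act on row vectors on the right; $\perp$ denotes block diagonal sum. The form on $Q=R^2\oplus P$ is $\langle(a,b,p),(a',b',p')\rangle=ab'-ba'+\langle p,p'\rangle$. The elementary symplectic transvections of $Q$ are $\rho(q,\alpha):(a,b,p)\mapsto(a,\,b-\langle p,q\rangle-\alpha a,\,p-aq)$ and $\mu(q,\beta):(a,b,p)\mapsto(a+\langle p,q\rangle+\beta b,\,b,\,p-bq)$, with $q\in P$, $\alpha,\beta\in R$. $\mathrm{ETrans}_{\mathrm{Sp}}(Q,\langle\,,\rangle)$ is the group they generate; $\mathrm{ETrans}_{\mathrm{Sp}}(IQ,\langle\,,\rangle)$ is the subgroup generated by those with $q\in IP$, $\alpha,\beta\in I$; $\mathrm{ETrans}_{\mathrm{Sp}}(Q,IQ,\langle\,,\rangle)$ is the normal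 closure of the latter in the former. Let $\sigma$ be the permutation $\sigma(2i)=2i-1$, $\sigma(2i-1)=2i$. For $z\in R$ and $1\le i\ne j\le 2m$ set $se_{ij}(z)=1_{2m}+ze_{ij}$ if $i=\sigma(j)$, and $se_{ij}(z)=1_{2m}+ze_{ij}-(-1)^{i+j}ze_{\sigma(j)\sigma(i)}$ if $i\ne\sigma(j)$. $\mathrm{ESp}_{2m}(R)$ is the group generated by all $se_{ij}(z)$, $z\in R$; $\mathrm{ESp}_{2m}(I)$ is the subgroup generated by all $se_{ij}(x)$, $x\in I$; $\mathrm{ESp}_{2m}(R,I)$ is the normal closure of $\mathrm{ESp}_{2m}(I)$ in $\mathrm{ESp}_{2m}(R)$. *)

theory Defs
  imports
    "Jordan_Normal_Form.Matrix"
    "HOL-Algebra.Bij"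
    "HOL-Algebra.Generated_Groups"
begin

text \<open>
  The ring \<open>R\<close> is a type of class \<^class>\<open>comm_ring_1\<close>; the module \<open>P\<close> is a type of class
  \<^class>\<open>ab_group_add\<close> with scalar multiplication \<open>scale\<close> satisfying \<^const>\<open>Modules.module\<close>.
  An ideal of \<open>R\<close> is a submodule of \<open>R\<close> over itself, \<open>Modules.module.subspace (*) I\<close>.
\<close>

definition normal_closure :: "('g, 'm) monoid_scheme \<Rightarrow> 'g set \<Rightarrow> 'g set \<Rightarrow> 'g set" where
  "normal_closure G K H = (\<lambda>N. N \<lhd> (G\<lparr>carrier := K\<rparr>)) hull H"


section \<open>Elementary symplectic matrices\<close>

text \<open>
  Row and column indices of matrices start at 0 in the library. The mathematical indices below
  start at 1, and \<open>mat_unit\<close> translates between the two.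
\<close>

definition mat_unit :: "nat \<Rightarrow> nat \<Rightarrow> nat \<Rightarrow> 'a::comm_ring_1 mat" where
  "mat_unit m i j = mat m m (\<lambda>(r, c). if r + 1 = i \<and> c + 1 = j then 1 else 0)"

definition psi :: "nat \<Rightarrow> 'a::comm_ring_1 mat" where
  "psi n = mat (2 * n) (2 * n) (\<lambda>rc.
     (\<Sum>i = 1..n. mat_unit (2 * n) (2 * i - 1) (2 * i) $$ rc)
     - (\<Sum>i = 1..n. mat_unit (2 * n) (2 * i) (2 * i - 1) $$ rc))"

text \<open>On row vectors, this is \<open>p \<phi> q\<^sup>t\<close>.\<close>

definition matrix_form :: "'a::comm_ring_1 mat \<Rightarrow> 'a vec \<Rightarrow> 'a vec \<Rightarrow> 'a" where
  "matrix_form \<phi> p q = p \<bullet> (\<phi> *\<^sub>v q)"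

definition sigma :: "nat \<Rightarrow> nat" where
  "sigma i = (if even i then i - 1 else i + 1)"

definition se :: "nat \<Rightarrow> nat \<Rightarrow> nat \<Rightarrow> 'a::comm_ring_1 \<Rightarrow> 'a mat" where
  "se m i j z =
     (if i = sigma j then 1\<^sub>m m + z \<cdot>\<^sub>m mat_unit m i j
      else 1\<^sub>m m + z \<cdot>\<^sub>m mat_unit m i j
             - ((-1) ^ (i + j) * z) \<cdot>\<^sub>m mat_unit m (sigma j) (sigma i))"

definition se_gens :: "nat \<Rightarrow> 'a::comm_ring_1 set \<Rightarrow> 'a mat set" where
  "se_gens m X = {se m i j x | i j x. i \<in> {1..m} \<and> j \<in> {1..m} \<and> i \<noteq> j \<and> x \<in> X}"

definition GL :: "nat \<Rightarrow> 'a::comm_ring_1 mat monoid" where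
  "GL m = units_of (ring_mat TYPE('a) m ())"

text \<open>
  For an ideal \<open>I\<close>, \<open>ESp m I\<close> is the (absolute) group \<open>ESp\<^sub>m(I)\<close>, and \<open>ESp m UNIV\<close> is \<open>ESp\<^sub>m(R)\<close>.
\<close>

definition ESp :: "nat \<Rightarrow> 'a::comm_ring_1 set \<Rightarrow> 'a mat set" where
  "ESp m X = generate (GL m) (se_gens m X)"

definition ESp_rel :: "nat \<Rightarrow> 'a::comm_ring_1 set \<Rightarrow> 'a mat set" where
  "ESp_rel m I = normal_closure (GL m) (ESp m UNIV) (ESp m I)"


section \<open>Elementary symplectic transvections\<close>

text \<open>
  \<open>Q = R\<^sup>2 \<oplus> P\<close> is the type \<^typ>\<open>'a \<times> 'a \<times> 'p\<close>, and \<open>B\<close> is the symplectic form on \<open>P\<close>.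
\<close>

definition form_Q :: "('p \<Rightarrow> 'p \<Rightarrow> 'a) \<Rightarrow> 'a \<times> 'a \<times> 'p \<Rightarrow> 'a \<times> 'a \<times> 'p \<Rightarrow> 'a::comm_ring_1" where
  "form_Q B = (\<lambda>(a, b, p) (a', b', p'). a * b' - b * a' + B p p')"

definition rho ::
  "('a \<Rightarrow> 'p \<Rightarrow> 'p) \<Rightarrow> ('p \<Rightarrow> 'p \<Rightarrow> 'a) \<Rightarrow> 'p \<Rightarrow> 'a \<Rightarrow>
   'a::comm_ring_1 \<times> 'a \<times> 'p::ab_group_add \<Rightarrow> 'a \<times> 'a \<times> 'p" where
  "rho scale B q \<alpha> = (\<lambda>(a, b, p). (a, b - B p q - \<alpha> * a, p - scale a q))"

definition mu ::
  "('a \<Rightarrow> 'p \<Rightarrow> 'p) \<Rightarrow> ('p \<Rightarrow> 'p \<Rightarrow> 'a) \<Rightarrow> 'p \<Rightarrow> 'a \<Rightarrow>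
   'a::comm_ring_1 \<times> 'a \<times> 'p::ab_group_add \<Rightarrow> 'a \<times> 'a \<times> 'p" where
  "mu scale B q \<beta> = (\<lambda>(a, b, p). (a + B p q + \<beta> * b, b, p - scale b q))"

definition ideal_times :: "('a::comm_ring_1 \<Rightarrow> 'p::ab_group_add \<Rightarrow> 'p) \<Rightarrow> 'a set \<Rightarrow> 'p set" where
  "ideal_times scale I = Modules.module.span scale {scale x p | x p. x \<in> I}"

text \<open>
  For an ideal \<open>I\<close>, \<open>ETrans scale B I\<close> is \<open>ETrans\<^sub>S\<^sub>p(IQ)\<close>, and \<open>ETrans scale B UNIV\<close> is \<open>ETrans\<^sub>S\<^sub>p(Q)\<close>,
  since \<open>RP = P\<close>. The ambient group consists of all bijections of \<open>Q\<close> under composition.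
\<close>

definition ETrans ::
  "('a \<Rightarrow> 'p \<Rightarrow> 'p) \<Rightarrow> ('p \<Rightarrow> 'p \<Rightarrow> 'a) \<Rightarrow> 'a set \<Rightarrow>
   ('a::comm_ring_1 \<times> 'a \<times> 'p::ab_group_add \<Rightarrow> 'a \<times> 'a \<times> 'p) set" where
  "ETrans scale B I = generate (BijGroup UNIV)
     ({rho scale B q \<alpha> | q \<alpha>. q \<in> ideal_times scale I \<and> \<alpha> \<in> I} \<union>
      {mu scale B q \<beta> | q \<beta>. q \<in> ideal_times scale I \<and> \<beta> \<in> I})"

definition ETrans_rel ::
  "('a \<Rightarrow> 'p \<Rightarrow> 'p) \<Rightarrow> ('p \<Rightarrow> 'p \<Rightarrow> 'a) \<Rightarrow> 'a set \<Rightarrow>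
   ('a::comm_ring_1 \<times> 'a \<times> 'p::ab_group_add \<Rightarrow> 'a \<times> 'a \<times> 'p) set" where
  "ETrans_rel scale B I =
     normal_closure (BijGroup UNIV) (ETrans scale B UNIV) (ETrans scale B I)"


section \<open>Coordinates\<close>

definition is_basis :: "('a::comm_ring_1 \<Rightarrow> 'p::ab_group_add \<Rightarrow> 'p) \<Rightarrow> nat \<Rightarrow> (nat \<Rightarrow> 'p) \<Rightarrow> bool" where
  "is_basis scale N e \<longleftrightarrow> inj_on e {..<N}
     \<and> \<not> Modules.module.dependent scale (e ` {..<N})
     \<and> Modules.module.span scale (e ` {..<N}) = UNIV"

definition coords_P ::
  "('a::comm_ring_1 \<Rightarrow> 'p::ab_group_add \<Rightarrow> 'p) \<Rightarrow> nat \<Rightarrow> (nat \<Rightarrow> 'p) \<Rightarrow> 'p \<Rightarrow> 'a vec" where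
  "coords_P scale N e p =
     vec N (\<lambda>k. Modules.module.representation scale (e ` {..<N}) p (e k))"

definition coords_Q ::
  "('a::comm_ring_1 \<Rightarrow> 'p::ab_group_add \<Rightarrow> 'p) \<Rightarrow> nat \<Rightarrow> (nat \<Rightarrow> 'p) \<Rightarrow> 'a \<times> 'a \<times> 'p \<Rightarrow> 'a vec" where
  "coords_Q scale N e = (\<lambda>(a, b, p). vCons a (vCons b (coords_P scale N e p)))"

definition basis_Q :: "(nat \<Rightarrow> 'p::ab_group_add) \<Rightarrow> nat \<Rightarrow> 'a::comm_ring_1 \<times> 'a \<times> 'p" where
  "basis_Q e k = (if k = 0 then (1, 0, 0) else if k = 1 then (0, 1, 0) else (0, 0, e (k - 2)))"

text \<open>
  Matrices act on row vectors from the right, so the rows of the matrix of \<open>f\<close> are the coordinate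
  vectors of the images of the basis vectors.
\<close>

definition matrix_Q ::
  "('a::comm_ring_1 \<Rightarrow> 'p::ab_group_add \<Rightarrow> 'p) \<Rightarrow> nat \<Rightarrow> (nat \<Rightarrow> 'p) \<Rightarrow>
   ('a \<times> 'a \<times> 'p \<Rightarrow> 'a \<times> 'a \<times> 'p) \<Rightarrow> 'a mat" where
  "matrix_Q scale N e f =
     mat_of_rows (N + 2) (map (\<lambda>k. coords_Q scale N e (f (basis_Q e k))) [0..<N + 2])"


section \<open>The form on \<open>Q\<close> is given by \<open>\<psi>\<^sub>1 \<bottom> \<psi>\<^sub>n = \<psi>\<^sub>n\<^sub>+\<^sub>1\<close>\<close>

lemma psi_index:
  assumes "r < 2 * n" "c < 2 * n"
  shows "psi n $$ (r, c) =
    (if even r \<and> c = r + 1 then 1 else if odd r \<and> r = c + 1 then - 1 else (0 :: 'a::comm_ring_1))"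
proof -
  have 1: "(r + 1 = 2 * i - 1 \<and> c + 1 = 2 * i) \<longleftrightarrow> (i = r div 2 + 1 \<and> even r \<and> c = r + 1)" for i
    by (cases i) (auto elim!: evenE)
  have 2: "(r + 1 = 2 * i \<and> c + 1 = 2 * i - 1) \<longleftrightarrow> (i = r div 2 + 1 \<and> odd r \<and> r = c + 1)" for i
    by (cases i) (auto elim!: oddE)
  have *: "(\<Sum>i = 1..n. mat_unit (2 * n) (2 * i - 1) (2 * i) $$ (r, c))
      = (\<Sum>i = 1..n. if i = r div 2 + 1 then (if even r \<and> c = r + 1 then 1 else 0) else (0 :: 'a))"
    using assms by (intro sum.cong refl) (simp only: mat_unit_def index_mat prod.case 1, simp)
  have **: "(\<Sum>i = 1..n. mat_unit (2 * n) (2 * i) (2 * i - 1) $$ (r, c))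
      = (\<Sum>i = 1..n. if i = r div 2 + 1 then (if odd r \<and> r = c + 1 then 1 else 0) else (0 :: 'a))"
    using assms by (intro sum.cong refl) (simp only: mat_unit_def index_mat prod.case 2, simp)
  have "r div 2 + 1 \<in> {1..n}" using assms by auto
  then have "psi n $$ (r, c) = (if even r \<and> c = r + 1 then 1 else (0 :: 'a))
      - (if odd r \<and> r = c + 1 then 1 else 0)"
    unfolding psi_def index_mat(1)[OF assms] * ** by (simp only: sum.delta finite_atLeastAtMost if_True)
  then show ?thesis by auto
qed

lemma psi_carrier: "psi n \<in> carrier_mat (2 * n) (2 * n)"
  by (simp add: psi_def)

lemma psi_dim [simp]: "dim_row (psi n) = 2 * n" "dim_col (psi n) = 2 * n"
  by (simp_all add: psi_def)

lemma psi_Suc: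
  "psi (Suc n) = four_block_mat (psi 1) (0\<^sub>m 2 (2 * n)) (0\<^sub>m (2 * n) 2) (psi n :: 'a::comm_ring_1 mat)"
    (is "_ = ?F")
proof (rule eq_matI)
  fix r c
  assume "r < dim_row ?F" "c < dim_col ?F"
  then have rc: "r < 2 + 2 * n" "c < 2 + 2 * n" by simp_all
  have L: "psi (Suc n) $$ (r, c) =
    (if even r \<and> c = r + 1 then 1 else if odd r \<and> r = c + 1 then - 1 else (0 :: 'a))"
    by (rule psi_index) (use rc in simp_all)
  have F: "?F $$ (r, c) = (if r < 2 then if c < 2 then psi 1 $$ (r, c) else 0\<^sub>m 2 (2 * n) $$ (r, c - 2)
      else if c < 2 then 0\<^sub>m (2 * n) 2 $$ (r - 2, c) else psi n $$ (r - 2, c - 2))"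
    by (subst index_mat_four_block) (use rc in simp_all)
  show "psi (Suc n) $$ (r, c) = ?F $$ (r, c)"
  proof (cases "r < 2"; cases "c < 2")
    assume "r < 2" "c < 2"
    then show ?thesis unfolding L F by (simp add: psi_index)
  next
    assume h: "r < 2" "\<not> c < 2"
    then have "c \<noteq> r + 1 \<or> odd r" "r \<noteq> c + 1" by presburger+
    then show ?thesis unfolding L F using h rc by auto
  next
    assume h: "\<not> r < 2" "c < 2"
    then have "c \<noteq> r + 1" "r \<noteq> c + 1 \<or> even r" by presburger+
    then show ?thesis unfolding L F using h rc by auto
  next
    assume h: "\<not> r < 2" "\<not> c < 2"
    then obtain r' c' where "r = r' + 2" "c = c' + 2"
      by (metis add.commute le_add_diff_inverse not_less)
    then show ?thesis unfolding L F using rc by (auto simp: psi_index)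
  qed
qed simp_all

lemma form_Q_psi:
  fixes B :: "'p::ab_group_add \<Rightarrow> 'p \<Rightarrow> 'a::comm_ring_1"
  assumes "\<And>p q. B p q = matrix_form (psi n) (coords_P scale (2 * n) e p) (coords_P scale (2 * n) e q)"
  shows "form_Q B u v =
    matrix_form (psi (Suc n)) (coords_Q scale (2 * n) e u) (coords_Q scale (2 * n) e v)"
proof -
  obtain a b p a' b' p' where uv: "u = (a, b, p)" "v = (a', b', p')" by (metis prod_cases3)
  define x y where "x = coords_P scale (2 * n) e p" and "y = coords_P scale (2 * n) e p'"
  have xy: "x \<in> carrier_vec (2 * n)" "y \<in> carrier_vec (2 * n)" by (auto simp: x_def y_def coords_P_def)
  have c: "vCons s (vCons t z) = vec_of_list [s, t] @\<^sub>v z" for s t :: 'a and z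
  proof -
    have "vec_of_list [] @\<^sub>v z = z" by (rule eq_vecI) simp_all
    then show ?thesis by simp
  qed
  have d: "vec_of_list [s, t] \<in> carrier_vec 2" for s t :: 'a by (rule carrier_vecI) simp
  have m: "psi (Suc n) *\<^sub>v (vec_of_list [a', b'] @\<^sub>v y)
      = (psi 1 *\<^sub>v vec_of_list [a', b']) @\<^sub>v (psi n *\<^sub>v y)"
    unfolding psi_Suc
    by (rule mult_mat_vec_split) (use psi_carrier[of n] psi_carrier[of 1] xy d in simp_all)
  have "matrix_form (psi (Suc n)) (vec_of_list [a, b] @\<^sub>v x) (vec_of_list [a', b'] @\<^sub>v y)
      = vec_of_list [a, b] \<bullet> (psi 1 *\<^sub>v vec_of_list [a', b']) + x \<bullet> (psi n *\<^sub>v y)"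
    unfolding matrix_form_def m
    by (rule scalar_prod_append[OF d xy(1) mult_mat_vec_carrier[OF _ d] mult_mat_vec_carrier[OF _ xy(2)]])
      (use psi_carrier[of n] psi_carrier[of 1] in simp_all)
  also have "vec_of_list [a, b] \<bullet> (psi 1 *\<^sub>v vec_of_list [a', b']) = a * b' - b * a'"
  proof -
    have "{0..<2::nat} = {0, 1}" by auto
    then show ?thesis by (simp add: scalar_prod_def psi_index vec_of_list_index del: vec_of_list_Cons)
  qed
  finally show ?thesis
    unfolding uv form_Q_def coords_Q_def prod.case assms c x_def y_def matrix_form_def by simp
qed

end

theory Submission
  imports Defs
begin

text \<open>
  Matrices are identified with linear maps of \<open>Q\<close>, and the two kinds of generators are compared
  as maps. Number the coordinates of \<open>Q = R\<^sup>2 \<oplus> P\<close> from 1, so that \<open>P\<close> carries the coordinates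
  from 3 on. A matrix \<open>se\<^sub>i\<^sub>j(x)\<close> with \<open>i\<close> or \<open>j\<close> in \<open>{1, 2}\<close> is, up to the symmetry
  \<open>se\<^sub>i\<^sub>j(z) = se\<^sub>\<sigma>\<^sub>j\<^sub>,\<^sub>\<sigma>\<^sub>i(\<plusminus>z)\<close> (lemma \<open>se_swap\<close>), one of the transvections \<open>\<rho>(0, \<alpha>)\<close>, \<open>\<mu>(0, \<beta>)\<close>,
  \<open>\<rho>(x e\<^sub>j, 0)\<close>, \<open>\<mu>(x e\<^sub>j, 0)\<close>. Two things remain.

  First, all transvections over an ideal \<open>I\<close> are products of these special ones: \<open>\<rho>(q, \<alpha>) \<circ> \<rho>(r, \<beta>)\<close>
  is \<open>\<rho>(q + r, \<gamma>)\<close> with \<open>\<gamma> = \<alpha> + \<beta> - \<langle>r, q\<rangle>\<close>, so \<open>q \<in> IP\<close> can be split into its coordinates. The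
  correction \<open>\<langle>r, q\<rangle>\<close> stays in \<open>I\<close>, and the same holds for \<open>\<mu>\<close>. Hence \<open>ETrans(IQ) \<subseteq> ESp(I)\<close>
  (lemma \<open>ETrans_subset_act_ESp\<close>).

  Second, the matrices \<open>se\<^sub>i\<^sub>j(x)\<close> with \<open>i, j \<ge> 3\<close> are commutators of transvections. If \<open>\<langle>q, r\<rangle> = 0\<close>,
  then the commutator of \<open>\<mu>(q, 0)\<close> and \<open>\<rho>(r, 0)\<close> fixes \<open>R\<^sup>2\<close> and maps \<open>p\<close> to
  \<open>p + \<langle>p, r\<rangle> q + \<langle>p, q\<rangle> r\<close> (lemma \<open>siegel_commutator\<close>). For \<open>q = e\<^sub>\<sigma>\<^sub>i\<close> and
  \<open>r = x e\<^sub>j\<close> this is \<open>se\<^sub>i\<^sub>j(\<plusminus>x)\<close>. If \<open>j = \<sigma>(i)\<close>, the two terms coincide and give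
  \<open>se\<^sub>i\<^sub>j(\<plusminus>2x)\<close>; this is where division by 2 enters. The commutator lies in the
  normal closure of \<open>ETrans(IQ)\<close> as soon as \<open>r \<in> IP\<close>, even for arbitrary \<open>q\<close>. So \<open>ESp(I)\<close> lies in
  \<open>ETrans(Q, IQ)\<close> (lemma \<open>act_ESp_subset_normal\<close>).

  For \<open>I = R\<close> the two inclusions say \<open>ESp(R) = ETrans(Q)\<close>. In general they say that \<open>ETrans(IQ)\<close> and
  \<open>ESp(I)\<close> have the same normal closure in this group.
\<close>

section \<open>Normal closures\<close>

lemma normal_closure_normal:
  assumes "group G" "subgroup K G" "H \<subseteq> K"
  shows "normal_closure G K H \<lhd> G\<lparr>carrier := K\<rparr>"
proof -
  interpret K: group "G\<lparr>carrier := K\<rparr>"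
    by (rule subgroup.subgroup_is_group[OF assms(2,1)])
  let ?F = "{N. N \<lhd> G\<lparr>carrier := K\<rparr> \<and> H \<subseteq> N}"
  have "K \<in> ?F"
    using K.normal_self assms(3) by simp
  then have "subgroup (\<Inter>?F) (G\<lparr>carrier := K\<rparr>)"
    by (intro K.subgroups_Inter) (auto simp: normal_imp_subgroup)
  then have "\<Inter>?F \<lhd> G\<lparr>carrier := K\<rparr>"
    unfolding K.normal_inv_iff by (auto simp: K.normal_inv_iff)
  then show ?thesis
    by (simp add: normal_closure_def hull_def)
qed

lemma subset_normal_closure: "H \<subseteq> normal_closure G K H"
  by (auto simp: normal_closure_def hull_def)

lemma normal_closure_least:
  assumes "N \<lhd> G\<lparr>carrier := K\<rparr>" "H \<subseteq> N"
  shows "normal_closure G K H \<subseteq> N"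
  using assms by (auto simp: normal_closure_def hull_def)

text \<open>
  Adding elements of the normal closure to the generators does not enlarge it.
\<close>

lemma normal_closure_eqI:
  assumes "A \<subseteq> B" "B \<subseteq> normal_closure G K A"
  shows "normal_closure G K A = normal_closure G K B"
  using assms unfolding normal_closure_def by (metis hull_hull hull_mono subset_antisym)

lemma normal_closure_subgroup:
  assumes "group G" "subgroup K G" "H \<subseteq> K"
  shows "subgroup (normal_closure G K H) G"
  using group.incl_subgroup[OF assms(1,2)] normal_imp_subgroup[OF normal_closure_normal[OF assms]]
  by blast

text \<open>
  The map restricts to a surjection from \<open>K\<close> onto its image. Surjections carry normal subgroups to
  normal subgroups, which gives one inclusion; preimages of normal subgroups are normal, which gives
  the other.
\<close>

lemma (in group_hom) image_normal_closure:
  assumes K: "subgroup K G" and A: "A \<subseteq> K"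
  shows "h ` normal_closure G K A = normal_closure H (h ` K) (h ` A)"
proof
  let ?GK = "G\<lparr>carrier := K\<rparr>" and ?HK = "H\<lparr>carrier := h ` K\<rparr>"
  have hK: "subgroup (h ` K) H"
    by (rule subgroup_img_is_subgroup[OF K])
  interpret K: group_hom ?GK ?HK h
  proof (intro group_hom.intro group_hom_axioms.intro)
    show "h \<in> hom ?GK ?HK"
      using subgroup.mem_carrier[OF K] by (auto simp: hom_def)
  qed (use subgroup.subgroup_is_group[OF K] subgroup.subgroup_is_group[OF hK] in auto)
  have "h ` normal_closure G K A \<lhd> ?HK"
    by (rule normal.surj_hom_normal_subgroup[OF normal_closure_normal[OF G.group_axioms K A]
      K.group_hom_axioms]) simp
  then show "normal_closure H (h ` K) (h ` A) \<subseteq> h ` normal_closure G K A"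
    by (rule normal_closure_least) (rule image_mono[OF subset_normal_closure])
  let ?C = "normal_closure H (h ` K) (h ` A)"
  let ?N = "{x \<in> K. h x \<in> ?C}"
  have C: "?C \<lhd> ?HK"
    using normal_closure_normal[OF H.group_axioms hK] A by blast
  note S = normal_imp_subgroup[OF C]
  have "subgroup ?N ?GK"
  proof (rule K.G.subgroupI)
    show "?N \<noteq> {}"
      using subgroup.one_closed[OF S] K.hom_one K.G.one_closed by auto
    show "inv\<^bsub>?GK\<^esub> a \<in> ?N" if "a \<in> ?N" for a
      using that subgroup.m_inv_closed[OF S, of "h a"] K.hom_inv[of a] K.G.inv_closed[of a] by simp
    show "a \<otimes>\<^bsub>?GK\<^esub> b \<in> ?N" if "a \<in> ?N" "b \<in> ?N" for a b
      using that subgroup.m_closed[OF S, of "h a" "h b"] K.hom_mult[of a b] K.G.m_closed[of a b]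
      by simp
  qed auto
  moreover have "x \<otimes>\<^bsub>?GK\<^esub> a \<otimes>\<^bsub>?GK\<^esub> inv\<^bsub>?GK\<^esub> x \<in> ?N" if "x \<in> carrier ?GK" "a \<in> ?N" for x a
  proof -
    have a: "a \<in> carrier ?GK" and ha: "h a \<in> ?C"
      using that(2) by simp_all
    have "h (x \<otimes>\<^bsub>?GK\<^esub> a \<otimes>\<^bsub>?GK\<^esub> inv\<^bsub>?GK\<^esub> x) = h x \<otimes>\<^bsub>?HK\<^esub> h a \<otimes>\<^bsub>?HK\<^esub> inv\<^bsub>?HK\<^esub> h x"
      by (simp only: K.hom_mult K.hom_inv that(1) a K.G.m_closed K.G.inv_closed)
    also have "\<dots> \<in> ?C"
      by (rule normal.inv_op_closed2[OF C K.hom_closed[OF that(1)] ha])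
    finally have "h (x \<otimes>\<^bsub>?GK\<^esub> a \<otimes>\<^bsub>?GK\<^esub> inv\<^bsub>?GK\<^esub> x) \<in> ?C" .
    moreover have "x \<otimes>\<^bsub>?GK\<^esub> a \<otimes>\<^bsub>?GK\<^esub> inv\<^bsub>?GK\<^esub> x \<in> carrier ?GK"
      by (intro K.G.m_closed K.G.inv_closed that(1) a)
    ultimately show ?thesis
      by simp
  qed
  ultimately have "?N \<lhd> ?GK"
    unfolding K.G.normal_inv_iff by blast
  then have "normal_closure G K A \<subseteq> ?N"
    by (rule normal_closure_least) (use A subset_normal_closure[of "h ` A" H "h ` K"] in blast)
  then show "h ` normal_closure G K A \<subseteq> ?C"
    by blast
qed

section \<open>Elementary symplectic matrices\<close>

lemma sigma_sigma [simp]: "i \<ge> 1 \<Longrightarrow> sigma (sigma i) = i"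
  by (auto simp: sigma_def)

lemma sigma_neq [simp]: "i \<ge> 1 \<Longrightarrow> sigma i \<noteq> i"
  by (auto simp: sigma_def)

lemma sigma_range: "even m \<Longrightarrow> i \<in> {1..m} \<Longrightarrow> sigma i \<in> {1..m}"
  unfolding sigma_def by (cases "i = m") (auto elim!: evenE)

lemma sigma_ge: "i \<ge> 3 \<Longrightarrow> sigma i \<ge> 3"
  unfolding sigma_def by (cases "i = 3") auto

lemma power_sigma: "k \<ge> 1 \<Longrightarrow> (-1) ^ sigma k = - ((-1) ^ k :: 'a::comm_ring_1)"
  by (auto simp: sigma_def minus_one_power_iff)

lemma se_carrier: "se m i j z \<in> carrier_mat m m"
  by (auto simp: se_def mat_unit_def)

lemma mat_unit_dim [simp]: "dim_row (mat_unit m k l) = m" "dim_col (mat_unit m k l) = m"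
  by (simp_all add: mat_unit_def)

text \<open>
  The row vector \<open>v M\<close> is \<open>M\<^sup>t v\<close> as a column vector, so this is the right action of \<open>se\<^sub>i\<^sub>j(z)\<close> on
  coordinates. The shift by one translates indices that start at 1 into positions of the vector.
\<close>

lemma se_transpose_mult:
  fixes w :: "'a::comm_ring_1 vec"
  assumes m: "even m" and i: "i \<in> {1..m}" and j: "j \<in> {1..m}" and w: "w \<in> carrier_vec m"
    and c: "c \<in> {1..m}"
  shows "(transpose_mat (se m i j z) *\<^sub>v w) $ (c - 1) =
    w $ (c - 1) + (if c = j then z * w $ (i - 1) else 0)
      - (if i \<noteq> sigma j \<and> c = sigma i then (-1) ^ (i + j) * z * w $ (sigma j - 1) else 0)"
proof -
  define s where "s = (if i \<noteq> sigma j \<and> c = sigma i then (-1) ^ (i + j) * z else 0)"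
  have j': "sigma j \<in> {1..m}"
    by (rule sigma_range[OF m j])
  have unit: "mat_unit m k l $$ (r, c - 1) = (if r = k - 1 \<and> c = l then 1 else 0 :: 'a)"
    if "r < m" "k \<ge> 1" for r k l
    using that c by (auto simp: mat_unit_def)
  have entry: "se m i j z $$ (r, c - 1) * w $ r =
      (if r = c - 1 then w $ r else 0) + (if r = i - 1 then (if c = j then z else 0) * w $ r else 0)
        - (if r = sigma j - 1 then s * w $ r else 0)" if r: "r < m" for r
  proof -
    have cm: "c - 1 < m"
      using c by auto
    have "se m i j z $$ (r, c - 1) = 1\<^sub>m m $$ (r, c - 1) + z * mat_unit m i j $$ (r, c - 1)
        - (if i = sigma j then 0 else (-1) ^ (i + j) * z) * mat_unit m (sigma j) (sigma i) $$ (r, c - 1)"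
      unfolding se_def using r cm
      by (simp only: index_add_mat index_minus_mat index_smult_mat index_one_mat mat_unit_dim
        carrier_matD split: if_split) simp
    also have "\<dots> = (if r = c - 1 then 1 else 0)
        + (if r = i - 1 then if c = j then z else 0 else 0) - (if r = sigma j - 1 then s else 0)"
    proof -
      have "1 \<le> i" "1 \<le> sigma j"
        using i j' by auto
      then show ?thesis
        unfolding unit[OF r \<open>1 \<le> i\<close>] unit[OF r \<open>1 \<le> sigma j\<close>] index_one_mat(1)[OF r cm] s_def
        by (simp split: if_split)
    qed
    finally have "se m i j z $$ (r, c - 1) = (if r = c - 1 then 1 else 0)
        + (if r = i - 1 then if c = j then z else 0 else 0) - (if r = sigma j - 1 then s else 0)" .
    then show ?thesis
      by (simp only: left_diff_distrib distrib_right if_distrib[of "\<lambda>y. y * w $ r"] mult_zero_left mult_1_left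
        cong: if_cong)
  qed
  have "(transpose_mat (se m i j z) *\<^sub>v w) $ (c - 1) = (\<Sum>r<m. se m i j z $$ (r, c - 1) * w $ r)"
    using c w se_carrier[of m i j z] by (auto simp: scalar_prod_def lessThan_atLeast0 intro!: sum.cong)
  also have "\<dots> = (\<Sum>r<m. (if r = c - 1 then w $ r else 0)
      + (if r = i - 1 then (if c = j then z else 0) * w $ r else 0)
      - (if r = sigma j - 1 then s * w $ r else 0))"
    by (intro sum.cong refl entry) simp
  also have "\<dots> = w $ (c - 1) + (if c = j then z else 0) * w $ (i - 1) - s * w $ (sigma j - 1)"
    using i c sigma_range[OF m j] by (auto simp: sum.distrib sum_subtractf)
  finally show ?thesis
    by (simp add: s_def)
qed

lemma mat_eqI_transpose_mult:
  assumes M: "M \<in> carrier_mat m m" and N: "N \<in> carrier_mat m m"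
    and eq: "\<And>w. w \<in> carrier_vec m \<Longrightarrow> transpose_mat M *\<^sub>v w = transpose_mat N *\<^sub>v w"
  shows "M = (N :: 'a::comm_ring_1 mat)"
proof (rule eq_rowI)
  fix i assume "i < dim_row N"
  moreover have "transpose_mat K *\<^sub>v unit_vec m i = row K i" if "K \<in> carrier_mat m m" "i < m" for K :: "'a mat"
    using that by (intro eq_vecI) auto
  ultimately show "row M i = row N i"
    using M N eq[of "unit_vec m i"] by simp
qed (use M N in auto)

lemma GL_carrier: "M \<in> carrier (GL m) \<Longrightarrow> M \<in> carrier_mat m m"
  by (auto simp: GL_def units_of_def Units_def ring_mat_def)

lemma GL_simps: "M \<otimes>\<^bsub>GL m\<^esub> N = M * N" "\<one>\<^bsub>GL m\<^esub> = 1\<^sub>m m"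
  by (simp_all add: GL_def units_of_def ring_mat_def)

lemma group_GL: "group (GL m)"
  unfolding GL_def by (rule monoid.units_group[OF ring.is_monoid[OF ring_mat]])

text \<open>
  Acting on a vector, \<open>se\<^sub>i\<^sub>j(z)\<close> changes only the coordinates \<open>j\<close> and \<open>\<sigma>(i)\<close>, by multiples of the
  coordinates \<open>i\<close> and \<open>\<sigma>(j)\<close>, which it fixes. So the changes made by \<open>z\<close> and \<open>-z\<close> cancel.
\<close>

lemma se_mult_se_minus:
  assumes m: "even m" and i: "i \<in> {1..m}" and j: "j \<in> {1..m}" and ij: "i \<noteq> j"
  shows "se m i j z * se m i j (- z) = 1\<^sub>m m"
proof (rule mat_eqI_transpose_mult)
  let ?T = "\<lambda>z. transpose_mat (se m i j z)"
  note se = se_carrier[of m i j]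
  show "se m i j z * se m i j (- z) \<in> carrier_mat m m"
    by (rule mult_carrier_mat[OF se se])
  fix w :: "'a vec" assume w: "w \<in> carrier_vec m"
  have zw: "?T z *\<^sub>v w \<in> carrier_vec m"
    using se[of z] w by auto
  have "transpose_mat (se m i j z * se m i j (- z)) *\<^sub>v w = ?T (- z) *\<^sub>v (?T z *\<^sub>v w)"
    using se[of z] se[of "- z"] w
    by (simp add: transpose_mult[OF se[of z] se[of "- z"]] assoc_mult_mat_vec[of _ m m _ m])
  also have "\<dots> = w"
  proof (rule eq_vecI)
    fix k assume "k < dim_vec w"
    then have k: "Suc k \<in> {1..m}"
      using w by auto
    have j': "sigma j \<in> {1..m}" and ne: "i \<noteq> sigma i" "sigma j \<noteq> j" "sigma j \<noteq> sigma i"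
      using i j ij sigma_range[OF m j] sigma_sigma[of i] sigma_sigma[of j] sigma_neq[of i] sigma_neq[of j]
      by (auto simp del: sigma_sigma sigma_neq)
    have "(?T z *\<^sub>v w) $ (i - 1) = w $ (i - 1)"
      unfolding se_transpose_mult[OF m i j w i] using ij ne by simp
    moreover have "(?T z *\<^sub>v w) $ (sigma j - 1) = w $ (sigma j - 1)"
      unfolding se_transpose_mult[OF m i j w j'] using ne by simp
    ultimately have "(?T (- z) *\<^sub>v (?T z *\<^sub>v w)) $ (Suc k - 1) = w $ (Suc k - 1)"
      unfolding se_transpose_mult[OF m i j zw k] se_transpose_mult[OF m i j w k] by simp
    then show "(?T (- z) *\<^sub>v (?T z *\<^sub>v w)) $ k = w $ k"
      by simp
  qed (use se[of "- z"] w in auto)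
  finally show "transpose_mat (se m i j z * se m i j (- z)) *\<^sub>v w = transpose_mat (1\<^sub>m m) *\<^sub>v w"
    using w by simp
qed simp

lemma
  fixes z :: "'a::comm_ring_1"
  assumes "even m" "i \<in> {1..m}" "j \<in> {1..m}" "i \<noteq> j"
  shows se_GL: "se m i j z \<in> carrier (GL m)"
    and inv_se: "inv\<^bsub>GL m\<^esub> (se m i j z) = se m i j (- z)"
proof -
  note 1 = se_mult_se_minus[OF assms, of z] se_mult_se_minus[OF assms, of "- z", simplified]
  show GL: "se m i j z \<in> carrier (GL m)" for z :: 'a
    using se_mult_se_minus[OF assms, of z] se_mult_se_minus[OF assms, of "- z"]
      se_carrier[of m i j z] se_carrier[of m i j "- z"]
    unfolding GL_def units_of_def Units_def ring_mat_def by auto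
  show "inv\<^bsub>GL m\<^esub> (se m i j z) = se m i j (- z)"
    using 1 GL[of z] GL[of "- z"]
    by (intro group.inv_equality[OF group_GL]) (simp_all add: GL_simps)
qed

lemma se_gens_GL: "even m \<Longrightarrow> se_gens m X \<subseteq> carrier (GL m)"
  by (auto simp: se_gens_def intro!: se_GL)

text \<open>
  Exchanging the two off-diagonal terms of \<open>se\<^sub>i\<^sub>j(z)\<close> moves an index 1 or 2 from the column position
  to the row position, so that only matrices with row index 1 or 2 have to be recognised as
  transvections.
\<close>

lemma se_swap:
  assumes "i \<ge> 1" "j \<ge> 1" "i \<noteq> sigma j"
  shows "se m i j z = se m (sigma j) (sigma i) (- ((-1) ^ (i + j) * z))"
proof -
  have s: "(-1) ^ (sigma j + sigma i) = ((-1) ^ (i + j) :: 'a)"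
    using assms by (auto simp: sigma_def minus_one_power_iff)
  have s2: "(-1) ^ (i + j) * ((-1) ^ (i + j) * z) = z"
    by (simp add: minus_one_power_iff)
  show ?thesis
    using assms s2 by (intro eq_matI) (auto simp: se_def s)
qed

section \<open>Ideals\<close>

lemma ideal_closed:
  fixes I :: "'a::comm_ring_1 set"
  assumes "Modules.module.subspace (*) I"
  shows "0 \<in> I" "x \<in> I \<Longrightarrow> y \<in> I \<Longrightarrow> x + y \<in> I" "x \<in> I \<Longrightarrow> c * x \<in> I" "x \<in> I \<Longrightarrow> - x \<in> I"
proof -
  have M: "Modules.module ((*) :: 'a \<Rightarrow> 'a \<Rightarrow> 'a)"
    by unfold_locales (simp_all add: algebra_simps)
  show "0 \<in> I" "x \<in> I \<Longrightarrow> y \<in> I \<Longrightarrow> x + y \<in> I" "x \<in> I \<Longrightarrow> c * x \<in> I" "x \<in> I \<Longrightarrow> - x \<in> I"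
    using assms module.subspace_neg[OF M assms, of x] by (auto simp: module.subspace_def[OF M])
qed

lemma UNIV_ideal: "Modules.module.subspace (*) (UNIV :: 'a::comm_ring_1 set)"
proof -
  have M: "Modules.module ((*) :: 'a \<Rightarrow> 'a \<Rightarrow> 'a)"
    by unfold_locales (simp_all add: algebra_simps)
  show ?thesis
    by (rule module.subspace_UNIV[OF M])
qed

section \<open>Transvections for an alternating form\<close>

locale alternating_form = Modules.module scale
  for scale :: "'a::comm_ring_1 \<Rightarrow> 'p::ab_group_add \<Rightarrow> 'p" +
  fixes B :: "'p \<Rightarrow> 'p \<Rightarrow> 'a"
  assumes B_add_left: "B (p + p') q = B p q + B p' q"
    and B_add_right: "B p (q + q') = B p q + B p q'"
    and B_scale_left: "B (scale c p) q = c * B p q"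
    and B_scale_right: "B p (scale c q) = c * B p q"
    and B_self [simp]: "B p p = 0"
begin

lemma B_minus_left: "B (- p) q = - B p q"
  using B_scale_left[of "- 1" p q] by simp

lemma B_minus_right: "B p (- q) = - B p q"
  using B_scale_right[of p "- 1" q] by simp

lemma B_zero_left [simp]: "B 0 q = 0"
  using B_scale_left[of 0 0 q] by simp

lemma B_zero_right [simp]: "B p 0 = 0"
  using B_scale_right[of p 0 0] by simp

lemma B_diff_left: "B (p - p') q = B p q - B p' q"
  using B_add_left[of p "- p'" q] by (simp add: B_minus_left)

lemma B_swap: "B q p = - B p q"
proof -
  have "B (p + q) (p + q) = B p q + B q p"
    unfolding B_add_left B_add_right by simp
  then show ?thesis
    by (simp add: eq_neg_iff_add_eq_0 add.commute)
qed

lemmas B_simps = B_add_left B_add_right B_scale_left B_scale_right B_minus_left B_minus_right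
  B_diff_left

text \<open>
  The transvections \<open>\<rho>(q, \<alpha>)\<close> form a Heisenberg group: the form enters as the cocycle.
\<close>

lemma rho_comp:
  "rho scale B q \<alpha> \<circ> rho scale B r \<beta> = rho scale B (q + r) (\<alpha> + \<beta> - B r q)"
  by (rule ext) (auto simp: rho_def B_simps algebra_simps)

lemma mu_comp:
  "mu scale B q \<alpha> \<circ> mu scale B r \<beta> = mu scale B (q + r) (\<alpha> + \<beta> - B r q)"
  by (rule ext) (auto simp: mu_def B_simps algebra_simps)

lemma rho_0: "rho scale B 0 0 = id" and mu_0: "mu scale B 0 0 = id"
  by (auto simp: rho_def mu_def fun_eq_iff)

lemma bij_rho: "bij (rho scale B q \<alpha>)"
  by (rule o_bij[of "rho scale B (- q) (- \<alpha>)"]) (simp_all add: rho_comp rho_0 B_simps)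

lemma bij_mu: "bij (mu scale B q \<alpha>)"
  by (rule o_bij[of "mu scale B (- q) (- \<alpha>)"]) (simp_all add: mu_comp mu_0 B_simps)

text \<open>
  This map of \<open>P\<close>, extended by the identity on \<open>R\<^sup>2\<close>, is the Siegel (or Eichler) transformation of
  the pair \<open>q, r\<close>. It is symmetric in \<open>q\<close> and \<open>r\<close>, and preserves the form if they are orthogonal.
\<close>

definition siegel :: "'p \<Rightarrow> 'p \<Rightarrow> 'a \<times> 'a \<times> 'p \<Rightarrow> 'a \<times> 'a \<times> 'p" where
  "siegel q r = (\<lambda>(a, b, p). (a, b, p + scale (B p r) q + scale (B p q) r))"

lemma siegel_commutator:
  assumes "B q r = 0"
  shows "siegel q r =
    mu scale B q 0 \<circ> rho scale B r 0 \<circ> mu scale B (- q) 0 \<circ> rho scale B (- r) 0"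
proof -
  have "B r q = 0"
    using assms B_swap[of q r] by simp
  with assms show ?thesis
    by (auto simp: siegel_def rho_def mu_def fun_eq_iff B_simps algebra_simps)
qed

abbreviation ETrans_gens :: "'a set \<Rightarrow> ('a \<times> 'a \<times> 'p \<Rightarrow> 'a \<times> 'a \<times> 'p) set" where
  "ETrans_gens I \<equiv> {rho scale B q \<alpha> | q \<alpha>. q \<in> ideal_times scale I \<and> \<alpha> \<in> I} \<union>
      {mu scale B q \<beta> | q \<beta>. q \<in> ideal_times scale I \<and> \<beta> \<in> I}"

lemma ETrans_gens_carrier: "ETrans_gens I \<subseteq> carrier (BijGroup UNIV)"
  using bij_rho bij_mu by (auto simp: BijGroup_def Bij_def)

lemma ETrans_subgroup: "subgroup (ETrans scale B I) (BijGroup UNIV)"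
  unfolding ETrans_def by (rule group.generate_is_subgroup[OF group_BijGroup ETrans_gens_carrier])

lemma rho_in_ETrans: "q \<in> ideal_times scale I \<Longrightarrow> \<alpha> \<in> I \<Longrightarrow> rho scale B q \<alpha> \<in> ETrans scale B I"
  unfolding ETrans_def by (rule generate.incl) blast

lemma mu_in_ETrans: "q \<in> ideal_times scale I \<Longrightarrow> \<alpha> \<in> I \<Longrightarrow> mu scale B q \<alpha> \<in> ETrans scale B I"
  unfolding ETrans_def by (rule generate.incl) blast

lemma scale_in_ideal_times: "x \<in> I \<Longrightarrow> scale x p \<in> ideal_times scale I"
  unfolding ideal_times_def by (rule span_base) blast

lemma ideal_times_UNIV: "ideal_times scale UNIV = UNIV"
  using scale_in_ideal_times[of 1 UNIV] by auto

lemma ideal_times_mono: "I \<subseteq> J \<Longrightarrow> ideal_times scale I \<subseteq> ideal_times scale J"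
  unfolding ideal_times_def by (rule span_mono) blast

lemma ETrans_mono: "I \<subseteq> J \<Longrightarrow> ETrans scale B I \<subseteq> ETrans scale B J"
  unfolding ETrans_def using ideal_times_mono[of I J]
  by (intro group.mono_generate[OF group_BijGroup]) blast

lemma BijGroup_mult:
  "bij f \<Longrightarrow> bij g \<Longrightarrow> f \<otimes>\<^bsub>BijGroup UNIV\<^esub> g = f \<circ> g"
  by (simp add: BijGroup_def Bij_def compose_def fun_eq_iff)

text \<open>
  The commutator is the product of a conjugate of \<open>\<rho>(r, 0)\<close> and of \<open>\<rho>(-r, 0)\<close>. Both factors lie in
  \<open>N\<close> because \<open>r \<in> IP\<close>; the conjugating \<open>\<mu>(q, 0)\<close> may be any element of \<open>ETrans(Q)\<close>.
\<close>

lemma siegel_in_normal: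
  assumes N: "N \<lhd> BijGroup UNIV\<lparr>carrier := ETrans scale B UNIV\<rparr>"
    and sub: "ETrans scale B I \<subseteq> N" and I: "0 \<in> I"
    and r: "r \<in> ideal_times scale I" and orth: "B q r = 0"
  shows "siegel q r \<in> N"
proof -
  let ?E = "BijGroup UNIV\<lparr>carrier := ETrans scale B UNIV\<rparr>"
  interpret N: normal N ?E
    by (rule N)
  have mu: "mu scale B s 0 \<in> carrier ?E" for s
    using mu_in_ETrans[of s UNIV 0] by (simp add: ideal_times_UNIV)
  have "mu scale B (- q) 0 \<otimes>\<^bsub>?E\<^esub> mu scale B q 0 = \<one>\<^bsub>?E\<^esub>"
    by (simp add: BijGroup_mult bij_mu mu_comp mu_0 B_simps) (simp add: BijGroup_def fun_eq_iff)
  then have inv: "inv\<^bsub>?E\<^esub> (mu scale B q 0) = mu scale B (- q) 0"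
    by (rule N.inv_equality[OF _ mu mu])
  have "- r \<in> ideal_times scale I"
    using r unfolding ideal_times_def by (rule span_neg)
  then have rho: "rho scale B r 0 \<in> N" "rho scale B (- r) 0 \<in> N"
    using sub r rho_in_ETrans I by auto
  \<comment> \<open>the bracketing shows the conjugate of an element of \<open>N\<close>, followed by an element of \<open>N\<close>\<close>
  have "mu scale B q 0 \<otimes>\<^bsub>?E\<^esub> rho scale B r 0 \<otimes>\<^bsub>?E\<^esub> mu scale B (- q) 0 \<otimes>\<^bsub>?E\<^esub> rho scale B (- r) 0 \<in> N"
    using subgroup.m_closed[OF N.subgroup_axioms N.inv_op_closed2[OF mu[of q] rho(1)] rho(2)] by (simp add: inv)
  then show ?thesis
    by (simp add: BijGroup_mult bij_mu bij_rho bij_comp siegel_commutator[OF orth])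
qed

end

section \<open>Coordinates with respect to a symplectic basis\<close>

text \<open>
  This shows that the form is alternating: the terms of \<open>p \<psi>\<^sub>n p\<^sup>t\<close> cancel within each hyperbolic
  plane. Skew-symmetry alone would give only \<open>2 \<langle>p, p\<rangle> = 0\<close>.
\<close>

lemma sum_pairs_eq_0:
  fixes f :: "nat \<Rightarrow> 'a::comm_monoid_add"
  assumes "\<And>i. i < n \<Longrightarrow> f (2 * i) + f (2 * i + 1) = 0"
  shows "(\<Sum>k<2 * n. f k) = 0"
  using assms by (induction n) (simp_all add: add.assoc)

locale symplectic_basis = Modules.module scale
  for scale :: "'a::comm_ring_1 \<Rightarrow> 'p::ab_group_add \<Rightarrow> 'p" +
  fixes B :: "'p \<Rightarrow> 'p \<Rightarrow> 'a" and n :: nat and e :: "nat \<Rightarrow> 'p"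
  assumes basis: "is_basis scale (2 * n) e"
    and form: "B p q = matrix_form (psi n) (coords_P scale (2 * n) e p) (coords_P scale (2 * n) e q)"
begin

abbreviation "coords \<equiv> coords_P scale (2 * n) e"

lemma coords_carrier [simp]: "coords p \<in> carrier_vec (2 * n)"
  by (simp add: coords_P_def)

lemma dim_coords [simp]: "dim_vec (coords p) = 2 * n"
  by (simp add: coords_P_def)

lemma indep: "independent (e ` {..<2 * n})" and span: "p \<in> span (e ` {..<2 * n})"
  using basis by (simp_all add: is_basis_def)

lemma coords_add: "coords (p + q) = coords p + coords q"
  by (rule eq_vecI) (simp_all add: coords_P_def representation_add[OF indep span span])

lemma coords_diff: "coords (p - q) = coords p - coords q"
  by (rule eq_vecI) (simp_all add: coords_P_def representation_diff[OF indep span span])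

lemma coords_scale: "coords (scale c p) = c \<cdot>\<^sub>v coords p"
  by (rule eq_vecI) (simp_all add: coords_P_def representation_scale[OF indep span])

lemma coords_0: "coords 0 = 0\<^sub>v (2 * n)"
  by (intro eq_vecI) (auto simp: coords_P_def representation_zero)

lemma coords_basis: "l < 2 * n \<Longrightarrow> coords (e l) = unit_vec (2 * n) l"
  using basis
  by (intro eq_vecI) (auto simp: coords_P_def representation_basis[OF indep] unit_vec_def is_basis_def inj_on_eq_iff)

lemma coords_sum: "k < 2 * n \<Longrightarrow> coords (\<Sum>x\<in>A. f x) $ k = (\<Sum>x\<in>A. coords (f x) $ k)"
  by (simp add: coords_P_def representation_sum[OF indep span])

lemma coords_expansion: "(\<Sum>k<2 * n. scale (coords p $ k) (e k)) = p"
proof -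
  have "(\<Sum>b\<in>e ` {..<2 * n}. scale (representation (e ` {..<2 * n}) p b) b) = p"
    by (rule sum_representation_eq[OF indep span]) auto
  then show ?thesis
    using basis by (simp add: sum.reindex is_basis_def coords_P_def)
qed

lemma psi_mult_index:
  assumes v: "v \<in> carrier_vec (2 * n)" and r: "r < 2 * n"
  shows "(psi n *\<^sub>v v) $ r = (if even r then v $ (r + 1) else - v $ (r - 1) :: 'a)"
proof -
  have "(psi n *\<^sub>v v) $ r = (\<Sum>c<2 * n. psi n $$ (r, c) * v $ c)"
    using v r by (auto simp: scalar_prod_def lessThan_atLeast0 intro!: sum.cong)
  also have "\<dots> = (\<Sum>c<2 * n. if c = (if even r then r + 1 else r - 1)
      then if even r then v $ c else - v $ c else 0)"
    using r by (intro sum.cong refl) (auto simp: psi_index elim!: oddE)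
  also have "\<dots> = (if even r then v $ (r + 1) else - v $ (r - 1))"
    using r by (auto elim!: evenE)
  finally show ?thesis .
qed

sublocale alternating_form scale B
proof
  fix p p' q q' c
  note psi = psi_carrier[of n]
  have 1: "psi n *\<^sub>v coords x \<in> carrier_vec (2 * n)" for x
    by (rule mult_mat_vec_carrier[OF psi]) simp
  show "B (p + p') q = B p q + B p' q"
    unfolding form matrix_form_def coords_add
    by (rule add_scalar_prod_distrib[OF _ _ 1]) simp_all
  show "B p (q + q') = B p q + B p q'"
    unfolding form matrix_form_def coords_add
    by (simp add: mult_add_distrib_mat_vec[OF psi] scalar_prod_add_distrib[OF _ 1 1])
  show "B (scale c p) q = c * B p q"
    unfolding form matrix_form_def coords_scale by simp
  have "psi n *\<^sub>v (c \<cdot>\<^sub>v coords q) = c \<cdot>\<^sub>v (psi n *\<^sub>v coords q)"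
    by (intro eq_vecI) simp_all
  then show "B p (scale c q) = c * B p q"
    using 1 unfolding form matrix_form_def coords_scale by simp
  have "(\<Sum>r<2 * n. coords p $ r * (psi n *\<^sub>v coords p) $ r) = 0"
    by (rule sum_pairs_eq_0) (simp add: psi_mult_index del: index_mult_mat_vec)
  then show "B p p = 0"
    unfolding form matrix_form_def scalar_prod_def by (simp add: lessThan_atLeast0)
qed

text \<open>
  The coordinates of \<open>P\<close> are numbered as coordinates of \<open>Q\<close>, hence from 3 to \<open>2n + 2\<close>. With this
  numbering \<open>\<sigma>\<close> pairs the hyperbolic partners.
\<close>

definition pcoord :: "'p \<Rightarrow> nat \<Rightarrow> 'a" where "pcoord p k = coords p $ (k - 3)"
definition pbasis :: "nat \<Rightarrow> 'p" where "pbasis k = e (k - 3)"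

text \<open>
  The size is a constant, not an abbreviation, to keep it from being rewritten to successors.
\<close>

definition m :: nat where "m = 2 * n + 2"

context
  fixes k :: nat
  assumes k: "k \<in> {3..m}"
begin

lemma k_less: "k - 3 < 2 * n"
  using k by (auto simp: m_def)

lemma pcoord_simps [simp]:
  "pcoord (p + q) k = pcoord p k + pcoord q k"
  "pcoord (p - q) k = pcoord p k - pcoord q k"
  "pcoord (scale c p) k = c * pcoord p k"
  using k_less by (simp_all add: pcoord_def coords_add coords_diff coords_scale)

lemma pcoord_pbasis: "l \<in> {3..m} \<Longrightarrow> pcoord (pbasis l) k = (if k = l then 1 else 0)"
  using k_less k by (auto simp: pcoord_def pbasis_def coords_basis m_def)

text \<open>
  A basis vector pairs only with its hyperbolic partner: for even \<open>k\<close> it is the second vector of its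
  plane, and the first one pairs with it to 1.
\<close>

lemma B_pbasis: "B p (pbasis k) = (-1) ^ k * pcoord p (sigma k)"
proof -
  have "B p (pbasis k) = - B (pbasis k) p"
    by (rule B_swap)
  also have "\<dots> = - (psi n *\<^sub>v coords p) $ (k - 3)"
    using k_less mult_mat_vec_carrier[OF psi_carrier coords_carrier, of p]
    unfolding form matrix_form_def pbasis_def coords_basis[OF k_less]
    by (simp add: scalar_prod_left_unit)
  also have "\<dots> = (-1) ^ k * pcoord p (sigma k)"
  proof (cases "even k")
    case True
    then have "odd (k - 3)" "k - 3 - 1 = sigma k - 3"
      using k by (auto simp: sigma_def)
    then show ?thesis
      using True k_less unfolding psi_mult_index[OF coords_carrier k_less] by (simp add: pcoord_def)
  next
    case False
    then have "even (k - 3)" "k - 3 + 1 = sigma k - 3"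
      using k by (auto simp: sigma_def)
    then show ?thesis
      using False k_less unfolding psi_mult_index[OF coords_carrier k_less] by (simp add: pcoord_def)
  qed
  finally show ?thesis .
qed

end

definition coord :: "'a \<times> 'a \<times> 'p \<Rightarrow> nat \<Rightarrow> 'a" where
  "coord v k = coords_Q scale (2 * n) e v $ (k - 1)"

lemma coord_simps:
  "coord (a, b, p) (Suc 0) = a"
  "coord (a, b, p) 2 = b"
  "3 \<le> k \<Longrightarrow> coord (a, b, p) k = pcoord p k"
proof -
  assume "3 \<le> k"
  then have "k - 1 = Suc (Suc (k - 3))"
    by simp
  then show "coord (a, b, p) k = pcoord p k"
    by (simp add: coord_def coords_Q_def pcoord_def)
qed (simp_all add: coord_def coords_Q_def)

lemma coords_Q_carrier [simp]: "coords_Q scale (2 * n) e v \<in> carrier_vec m"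
  by (cases v) (simp add: coords_Q_def carrier_vecI m_def)

definition of_coords :: "'a vec \<Rightarrow> 'a \<times> 'a \<times> 'p" where
  "of_coords w = (w $ 0, w $ 1, \<Sum>k<2 * n. scale (w $ (k + 2)) (e k))"

lemma of_coords_coords_Q [simp]: "of_coords (coords_Q scale (2 * n) e v) = v"
  by (cases v) (simp add: of_coords_def coords_Q_def coords_expansion)

lemma coords_Q_of_coords [simp]:
  assumes "w \<in> carrier_vec m"
  shows "coords_Q scale (2 * n) e (of_coords w) = w"
proof (rule eq_vecI)
  fix k assume "k < dim_vec w"
  then have "k < m"
    using assms by auto
  moreover have "coords (\<Sum>l<2 * n. scale (w $ (l + 2)) (e l)) $ k' = w $ Suc (Suc k')" if "k' < 2 * n" for k'
    using that by (simp add: coords_sum coords_scale coords_basis if_distrib cong: if_cong)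
  ultimately show "coords_Q scale (2 * n) e (of_coords w) $ k = w $ k"
    by (auto simp: of_coords_def coords_Q_def m_def numeral_2_eq_2 less_Suc_eq_0_disj)
qed (use assms carrier_vecD[OF coords_Q_carrier] in simp)

lemma unit_vec_vCons:
  "unit_vec (Suc k) 0 = vCons (1 :: 'a) (0\<^sub>v k)" "unit_vec (Suc k) (Suc l) = vCons (0 :: 'a) (unit_vec k l)"
  "0\<^sub>v (Suc k) = vCons (0 :: 'a) (0\<^sub>v k)"
  by (auto intro!: eq_vecI simp: unit_vec_def vCons_def split: nat.split)

text \<open>
  Row vectors of coordinates are multiplied by \<open>M\<close> from the right, hence the transpose.
\<close>

definition right_mult :: "'a mat \<Rightarrow> 'a \<times> 'a \<times> 'p \<Rightarrow> 'a \<times> 'a \<times> 'p" where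
  "right_mult M v = of_coords (transpose_mat M *\<^sub>v coords_Q scale (2 * n) e v)"

lemma right_mult_one: "right_mult (1\<^sub>m m) = id"
  by (simp add: right_mult_def fun_eq_iff)

lemma right_mult_mult:
  assumes "M \<in> carrier_mat m m" "N \<in> carrier_mat m m"
  shows "right_mult (M * N) = right_mult N \<circ> right_mult M"
  using assms
  by (auto simp: right_mult_def fun_eq_iff transpose_mult[OF assms] assoc_mult_mat_vec[of _ m m _ m]
    coords_Q_of_coords[OF mult_mat_vec_carrier[of _ m m]])

lemma right_mult_eqI:
  assumes M: "M \<in> carrier_mat m m"
    and eq: "\<And>v k. k \<in> {1..m} \<Longrightarrow> coord (f v) k = (transpose_mat M *\<^sub>v coords_Q scale (2 * n) e v) $ (k - 1)"
  shows "right_mult M = f"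
proof
  fix v
  have "coords_Q scale (2 * n) e (f v) = transpose_mat M *\<^sub>v coords_Q scale (2 * n) e v"
    using M eq[of "Suc k" v for k] carrier_vecD[OF coords_Q_carrier, of "f v"]
    by (intro eq_vecI) (auto simp: coord_def)
  then show "right_mult M v = f v"
    by (metis right_mult_def of_coords_coords_Q)
qed

lemma matrix_Q_right_mult:
  assumes M: "M \<in> carrier_mat m m"
  shows "matrix_Q scale (2 * n) e (right_mult M) = M"
proof (rule eq_rowI)
  have b: "coords_Q scale (2 * n) e (basis_Q e k) = unit_vec m k" if k: "k < m" for k
  proof -
    consider "k = 0" | "k = 1" | k' where "k = Suc (Suc k')" "k' < 2 * n"
      using k by (cases k; cases "k - 1") (auto simp: m_def)
    then show ?thesis
      by cases (simp_all add: coords_0 basis_Q_def coords_Q_def coords_basis m_def unit_vec_vCons)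
  qed
  fix i assume "i < dim_row M"
  then have i: "i < m"
    using M by auto
  have "transpose_mat M *\<^sub>v unit_vec m i = row M i"
    using M i by (intro eq_vecI) auto
  moreover have "matrix_Q scale (2 * n) e (right_mult M) =
      mat_of_rows m (map (\<lambda>k. transpose_mat M *\<^sub>v coords_Q scale (2 * n) e (basis_Q e k)) [0..<m])"
    unfolding matrix_Q_def m_def[symmetric] right_mult_def
    using M by (simp add: coords_Q_of_coords[OF mult_mat_vec_carrier[of _ m m]])
  ultimately show "row (matrix_Q scale (2 * n) e (right_mult M)) i = row M i"
    using M i by (simp add: b)
qed (use M in \<open>auto simp: matrix_Q_def m_def\<close>)

section \<open>Elementary symplectic matrices act as transvections\<close>

lemma even_m: "even m"
  by (simp add: m_def)

text \<open>
  Multiplication from the right reverses products (lemma \<open>right_mult_mult\<close>). Composing it with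
  inversion gives a homomorphism, and on subgroups the inversion makes no difference.
\<close>

definition act :: "'a mat \<Rightarrow> 'a \<times> 'a \<times> 'p \<Rightarrow> 'a \<times> 'a \<times> 'p" where
  "act M = right_mult (inv\<^bsub>GL m\<^esub> M)"

lemma act_hom: "group_hom (GL m) (BijGroup UNIV) act"
proof (intro group_hom.intro group_hom_axioms.intro)
  interpret GL: group "GL m :: 'a mat monoid"
    by (rule group_GL)
  have bij: "bij (act M)" if "M \<in> carrier (GL m)" for M
  proof (rule o_bij)
    note c = GL_carrier[OF that] GL_carrier[OF GL.inv_closed[OF that]]
    show "right_mult M \<circ> act M = id" "act M \<circ> right_mult M = id"
      unfolding act_def
      using right_mult_mult[OF c(2,1)] right_mult_mult[OF c] GL.l_inv[OF that] GL.r_inv[OF that]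
      by (simp_all add: GL_simps right_mult_one)
  qed
  show "act \<in> hom (GL m) (BijGroup UNIV)"
  proof (rule homI)
    show "act M \<in> carrier (BijGroup UNIV)" if "M \<in> carrier (GL m)" for M
      using bij[OF that] by (simp add: BijGroup_def Bij_def)
    show "act (M \<otimes>\<^bsub>GL m\<^esub> N) = act M \<otimes>\<^bsub>BijGroup UNIV\<^esub> act N"
      if M: "M \<in> carrier (GL m)" and N: "N \<in> carrier (GL m)" for M N
    proof -
      have "act (M \<otimes>\<^bsub>GL m\<^esub> N) = act M \<circ> act N"
        using GL_carrier[OF GL.inv_closed[OF M]] GL_carrier[OF GL.inv_closed[OF N]]
        unfolding act_def GL.inv_mult_group[OF M N] by (simp add: GL_simps right_mult_mult)
      then show ?thesis
        by (simp add: BijGroup_mult[OF bij[OF M] bij[OF N]])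
    qed
  qed
qed (rule group_GL, rule group_BijGroup)

lemma act_se:
  assumes "i \<in> {1..m}" "j \<in> {1..m}" "i \<noteq> j"
  shows "act (se m i j z) = right_mult (se m i j (- z))"
  by (simp add: act_def inv_se[OF even_m assms])

lemma right_mult_se_eqI:
  assumes i: "i \<in> {1..m}" and j: "j \<in> {1..m}"
    and eq: "\<And>v k. k \<in> {1..m} \<Longrightarrow> coord (f v) k = coord v k + (if k = j then z * coord v i else 0)
      - (if i \<noteq> sigma j \<and> k = sigma i then (-1) ^ (i + j) * z * coord v (sigma j) else 0)"
  shows "right_mult (se m i j z) = f"
proof (rule right_mult_eqI[OF se_carrier])
  show "coord (f v) k = (transpose_mat (se m i j z) *\<^sub>v coords_Q scale (2 * n) e v) $ (k - 1)"
    if k: "k \<in> {1..m}" for v k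
    unfolding se_transpose_mult[OF even_m i j coords_Q_carrier k] using eq[OF k, of v] by (simp only: coord_def)
qed

lemma m_range: "1 \<in> {1..m}" "2 \<in> {1..m}"
  by (simp_all add: m_def)

lemma coord_cases:
  assumes "k \<in> {1..m}"
  obtains "k = 1" | "k = 2" | "k \<in> {3..m}"
  using assms by fastforce

lemma sigma_1_2 [simp]: "sigma (Suc 0) = 2" "sigma 2 = Suc 0"
  by (simp_all add: sigma_def)

lemma sigma_range3: "k \<in> {3..m} \<Longrightarrow> sigma k \<in> {3..m}"
  using sigma_ge[of k] sigma_range[OF even_m, of k] by auto

text \<open>
  The next lemmas identify the generators \<open>se\<^sub>i\<^sub>j(z)\<close> whose row index is 1 or 2 with transvections,
  by comparing coordinates.
\<close>

lemma right_mult_se_12: "right_mult (se m 1 2 z) = rho scale B 0 (- z)"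
proof (rule right_mult_se_eqI[OF m_range])
  fix v :: "'a \<times> 'a \<times> 'p" and k assume "k \<in> {1..m}"
  then show "coord (rho scale B 0 (- z) v) k = coord v k + (if k = 2 then z * coord v 1 else 0)
      - (if 1 \<noteq> sigma 2 \<and> k = sigma 1 then (-1) ^ (1 + 2) * z * coord v (sigma 2) else 0)"
    by (cases v; cases rule: coord_cases) (auto simp: rho_def coord_simps)
qed

lemma right_mult_se_21: "right_mult (se m 2 1 z) = mu scale B 0 z"
proof (rule right_mult_se_eqI[OF m_range(2,1)])
  fix v :: "'a \<times> 'a \<times> 'p" and k assume "k \<in> {1..m}"
  then show "coord (mu scale B 0 z v) k = coord v k + (if k = 1 then z * coord v 2 else 0)
      - (if 2 \<noteq> sigma 1 \<and> k = sigma 2 then (-1) ^ (2 + 1) * z * coord v (sigma 1) else 0)"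
    by (cases v; cases rule: coord_cases) (auto simp: mu_def coord_simps)
qed

lemma right_mult_se_1:
  assumes j: "j \<in> {3..m}"
  shows "right_mult (se m 1 j z) = rho scale B (scale (- z) (pbasis j)) 0"
proof (rule right_mult_se_eqI[OF m_range(1)])
  show "j \<in> {1..m}"
    using j by simp
  have s: "sigma j \<ge> 3"
    using sigma_range3[OF j] by simp
  fix v :: "'a \<times> 'a \<times> 'p" and k assume "k \<in> {1..m}"
  then show "coord (rho scale B (scale (- z) (pbasis j)) 0 v) k = coord v k
      + (if k = j then z * coord v 1 else 0)
      - (if 1 \<noteq> sigma j \<and> k = sigma 1 then (-1) ^ (1 + j) * z * coord v (sigma j) else 0)"
    using j s by (cases v; cases rule: coord_cases)
      (auto simp: rho_def coord_simps B_scale_right B_minus_right B_pbasis pcoord_pbasis algebra_simps)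
qed

lemma right_mult_se_2:
  assumes j: "j \<in> {3..m}"
  shows "right_mult (se m 2 j z) = mu scale B (scale (- z) (pbasis j)) 0"
proof (rule right_mult_se_eqI[OF m_range(2)])
  show "j \<in> {1..m}"
    using j by simp
  have s: "sigma j \<ge> 3"
    using sigma_range3[OF j] by simp
  fix v :: "'a \<times> 'a \<times> 'p" and k assume "k \<in> {1..m}"
  then show "coord (mu scale B (scale (- z) (pbasis j)) 0 v) k = coord v k
      + (if k = j then z * coord v 2 else 0)
      - (if 2 \<noteq> sigma j \<and> k = sigma 2 then (-1) ^ (2 + j) * z * coord v (sigma j) else 0)"
    using j s by (cases v; cases rule: coord_cases)
      (auto simp: mu_def coord_simps B_scale_right B_minus_right B_pbasis pcoord_pbasis algebra_simps)
qed

text \<open>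
  The two terms of the Siegel transformation pick out the coordinates \<open>p\<^sub>i = \<plusminus>\<langle>p, e\<^sub>\<sigma>\<^sub>i\<rangle>\<close> and
  \<open>p\<^sub>\<sigma>\<^sub>j = \<plusminus>\<langle>p, e\<^sub>j\<rangle>\<close>, and these are the two off-diagonal entries of \<open>se\<^sub>i\<^sub>j(z)\<close>. The factor \<open>-(-1)\<^sup>i\<close>
  makes up for the sign of \<open>\<langle>p, e\<^sub>\<sigma>\<^sub>i\<rangle>\<close>.
\<close>

lemma right_mult_se_short:
  assumes i: "i \<in> {3..m}" and j: "j \<in> {3..m}" and ij: "i \<noteq> j" "i \<noteq> sigma j"
  shows "right_mult (se m i j z) = siegel (pbasis (sigma i)) (scale (- ((-1) ^ i) * z) (pbasis j))"
proof (rule right_mult_se_eqI)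
  show "i \<in> {1..m}" "j \<in> {1..m}"
    using i j by simp_all
  note s = sigma_range3[OF i] sigma_range3[OF j]
  have si: "sigma (sigma i) = i"
    using i by simp
  have p: "(-1) ^ i * ((-1) ^ i * x) = x" for x :: 'a
    by (simp add: minus_one_power_iff)
  fix v :: "'a \<times> 'a \<times> 'p" and k assume "k \<in> {1..m}"
  then show "coord (siegel (pbasis (sigma i)) (scale (- ((-1) ^ i) * z) (pbasis j)) v) k = coord v k
      + (if k = j then z * coord v i else 0)
      - (if i \<noteq> sigma j \<and> k = sigma i then (-1) ^ (i + j) * z * coord v (sigma j) else 0)"
    using i j ij s by (cases v; cases rule: coord_cases)
      (auto simp: siegel_def coord_simps B_scale_right B_minus_right B_pbasis pcoord_pbasis power_add power_sigma si p mult.assoc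
        mult.left_commute)
qed

text \<open>
  For \<open>j = \<sigma>(i)\<close> both terms of the Siegel transformation equal \<open>\<plusminus>h z p\<^sub>i e\<^sub>j\<close>, and the matrix has only
  one off-diagonal entry. Hence the half.
\<close>

lemma right_mult_se_long:
  assumes i: "i \<in> {3..m}" and h: "2 * h = (1 :: 'a)"
  shows "right_mult (se m i (sigma i) z) =
    siegel (pbasis (sigma i)) (scale (- ((-1) ^ i) * (h * z)) (pbasis (sigma i)))"
proof (rule right_mult_se_eqI)
  note s = sigma_range3[OF i]
  show "i \<in> {1..m}" "sigma i \<in> {1..m}"
    using i s by simp_all
  have si: "sigma (sigma i) = i"
    using i by simp
  have p: "(-1) ^ i * ((-1) ^ i * x) = x" for x :: 'a
    by (simp add: minus_one_power_iff)
  have h2: "h * (z * (2 * x)) = z * x" for x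
    using arg_cong[OF h, of "\<lambda>y. y * (z * x)"] by (simp add: ac_simps)
  fix v :: "'a \<times> 'a \<times> 'p" and k assume "k \<in> {1..m}"
  then show "coord (siegel (pbasis (sigma i)) (scale (- ((-1) ^ i) * (h * z)) (pbasis (sigma i))) v) k = coord v k
      + (if k = sigma i then z * coord v i else 0)
      - (if i \<noteq> sigma (sigma i) \<and> k = sigma i then (-1) ^ (i + sigma i) * z * coord v (sigma (sigma i)) else 0)"
    using i s by (cases v; cases rule: coord_cases)
      (auto simp: siegel_def coord_simps B_scale_right B_minus_right B_pbasis pcoord_pbasis power_add power_sigma si p mult.assoc
        mult.left_commute h2)
qed

section \<open>Comparison of the two groups\<close>

text \<open>
  The case distinction is on which of \<open>i\<close> and \<open>j\<close> belong to \<open>R\<^sup>2\<close>. If at least one does, the matrix is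
  itself a transvection over \<open>I\<close>; otherwise it is a Siegel transformation, and the factor \<open>x \<in> I\<close>
  is put into its second vector.
\<close>

lemma right_mult_se_in_normal:
  assumes I: "Modules.module.subspace (*) I" and h: "2 * h = (1 :: 'a)"
    and N: "N \<lhd> BijGroup UNIV\<lparr>carrier := ETrans scale B UNIV\<rparr>" and sub: "ETrans scale B I \<subseteq> N"
    and i: "i \<in> {1..m}" and j: "j \<in> {1..m}" and ij: "i \<noteq> j" and x: "x \<in> I"
  shows "right_mult (se m i j x) \<in> N"
proof -
  note ideal = ideal_closed[OF I]
  have sc: "scale y p \<in> ideal_times scale I" if "y \<in> I" for y p
    using that by (rule scale_in_ideal_times)
  have row1: "right_mult (se m 1 k y) \<in> N" if "y \<in> I" "k \<in> {3..m}" for y k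
    unfolding right_mult_se_1[OF that(2)] using sub rho_in_ETrans[OF sc ideal(1)] ideal(4) that(1) by blast
  have row2: "right_mult (se m 2 k y) \<in> N" if "y \<in> I" "k \<in> {3..m}" for y k
    unfolding right_mult_se_2[OF that(2)] using sub mu_in_ETrans[OF sc ideal(1)] ideal(4) that(1) by blast
  have swap: "- ((-1) ^ (i + j) * x) \<in> I"
    using x by (intro ideal)
  have zero: "0 \<in> ideal_times scale I"
    using sc[OF ideal(1), of 0] by simp
  have siegel: "siegel q (scale c p) \<in> N" if "c \<in> I" "B q p = 0" for q c p
    using siegel_in_normal[OF N sub ideal(1) sc[OF that(1)]] that(2) by (simp add: B_scale_right)
  show ?thesis
    using i
  proof (cases i rule: coord_cases)
    case i1: 1
    show ?thesis
      using j
    proof (cases j rule: coord_cases)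
      case 1
      then show ?thesis
        using i1 ij by simp
    next
      case 2
      then show ?thesis
        unfolding i1 2 right_mult_se_12 using sub rho_in_ETrans[OF zero ideal(4)[OF x]] by blast
    next
      case 3
      then show ?thesis
        using i1 row1[OF x] by simp
    qed
  next
    case i2: 2
    show ?thesis
      using j
    proof (cases j rule: coord_cases)
      case 1
      then show ?thesis
        unfolding i2 1 right_mult_se_21 using sub mu_in_ETrans[OF zero x] by blast
    next
      case 2
      then show ?thesis
        using i2 ij by simp
    next
      case 3
      then show ?thesis
        using i2 row2[OF x] by simp
    qed
  next
    case i3: 3
    note si = sigma_range3[OF i3]
    show ?thesis
      using j
    proof (cases j rule: coord_cases)
      case 1
      then show ?thesis
        using se_swap[of i j m x] i3 row2[OF swap si] by simp
    next
      case 2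
      then show ?thesis
        using se_swap[of i j m x] i3 row1[OF swap si] by simp
    next
      case j3: 3
      show ?thesis
      proof (cases "i = sigma j")
        case True
        then have "sigma i = j"
          using j3 by simp
        moreover have "- ((-1) ^ i) * (h * x) \<in> I"
          using x by (intro ideal)
        ultimately show ?thesis
          using right_mult_se_long[OF i3 h, of x] siegel[of "- ((-1) ^ i) * (h * x)" "pbasis j" "pbasis j"] by simp
      next
        case False
        have "- ((-1) ^ i) * x \<in> I"
          using x by (intro ideal)
        moreover have "B (pbasis (sigma i)) (pbasis j) = 0"
          using i3 si j3 ij sigma_sigma[of i] sigma_sigma[of j] sigma_range3[OF j3]
          by (auto simp: B_pbasis pcoord_pbasis simp del: sigma_sigma)
        ultimately show ?thesis
          unfolding right_mult_se_short[OF i3 j3 ij False] by (rule siegel)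
      qed
    qed
  qed
qed

lemma ESp_subgroup: "subgroup (ESp m I) (GL m)"
  unfolding ESp_def by (rule group.generate_is_subgroup[OF group_GL se_gens_GL[OF even_m]])

lemma ESp_mono: "I \<subseteq> J \<Longrightarrow> ESp m I \<subseteq> ESp m J"
  unfolding ESp_def by (intro group.mono_generate[OF group_GL]) (auto simp: se_gens_def)

lemma act_ESp_subgroup: "subgroup (act ` ESp m I) (BijGroup UNIV)"
  by (rule group_hom.subgroup_img_is_subgroup[OF act_hom ESp_subgroup])

lemma act_ESp_subset_normal:
  assumes I: "Modules.module.subspace (*) I" and h: "2 * h = (1 :: 'a)"
    and N: "N \<lhd> BijGroup UNIV\<lparr>carrier := ETrans scale B UNIV\<rparr>" and sub: "ETrans scale B I \<subseteq> N"
  shows "act ` ESp m I \<subseteq> N"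
proof -
  have "subgroup N (BijGroup UNIV)"
    by (rule group.incl_subgroup[OF group_BijGroup ETrans_subgroup normal_imp_subgroup[OF N]])
  moreover have "act ` se_gens m I \<subseteq> N"
    using right_mult_se_in_normal[OF I h N sub] ideal_closed(4)[OF I] by (auto simp: se_gens_def act_se)
  ultimately show ?thesis
    unfolding ESp_def group_hom.generate_img[OF act_hom se_gens_GL[OF even_m], symmetric]
    by (intro group.generate_subgroup_incl[OF group_BijGroup])
qed

lemma coords_ideal_times:
  assumes I: "Modules.module.subspace (*) I" and q: "q \<in> ideal_times scale I" and k: "k < 2 * n"
  shows "coords q $ k \<in> I"
  using q unfolding ideal_times_def
proof (induction rule: span_induct)
  case base
  show ?case
    using k ideal_closed[OF I] coords_scale[of 0 0] by (auto simp: subspace_def coords_add coords_scale coords_0)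
next
  case (step p)
  then obtain x r where "p = scale x r" "x \<in> I"
    by blast
  then show ?case
    using k ideal_closed(3)[OF I, of x "coords r $ k"] by (simp add: coords_scale mult.commute[of x "coords r $ k"])
qed

text \<open>
  Every \<open>q \<in> IP\<close> is a combination of basis vectors with coefficients in \<open>I\<close>. Induction on the number
  of its terms splits off the transvections along single basis vectors.
\<close>

lemma ETrans_subset_act_ESp:
  assumes I: "Modules.module.subspace (*) I"
  shows "ETrans scale B I \<subseteq> act ` ESp m I"
proof -
  let ?S = "act ` ESp m I"
  note ideal = ideal_closed[OF I]
  have comp: "f \<circ> g \<in> ?S" if "f \<in> ?S" "g \<in> ?S" for f g
  proof -
    have "bij f" "bij g"
      using that subgroup.mem_carrier[OF act_ESp_subgroup] by (auto simp: BijGroup_def Bij_def)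
    then show ?thesis
      using subgroup.m_closed[OF act_ESp_subgroup that] by (simp add: BijGroup_mult)
  qed
  have gen: "right_mult (se m i j x) \<in> ?S" if "i \<in> {1..m}" "j \<in> {1..m}" "i \<noteq> j" "x \<in> I" for i j x
  proof -
    have "se m i j (- x) \<in> ESp m I"
      unfolding ESp_def using that ideal(4) by (intro generate.incl) (auto simp: se_gens_def)
    then show ?thesis
      using act_se[OF that(1-3), of "- x"] by (metis imageI minus_minus)
  qed
  have B_I: "B q (scale x p) \<in> I" if "x \<in> I" for q p x
    using ideal(3)[OF that, of "B q p"] by (simp add: B_scale_right mult.commute)
  have sum: "rho scale B (\<Sum>k\<in>A. scale (x k) (e k)) \<alpha> \<in> ?S \<and> mu scale B (\<Sum>k\<in>A. scale (x k) (e k)) \<alpha> \<in> ?S"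
    if "finite A" "A \<subseteq> {..<2 * n}" "\<And>k. k < 2 * n \<Longrightarrow> x k \<in> I" "\<alpha> \<in> I" for A x \<alpha>
    using that
  proof (induction A arbitrary: \<alpha>)
    case empty
    show ?case
      using gen[OF m_range, of "- \<alpha>"] gen[OF m_range(2,1), of \<alpha>] ideal(4)[OF empty.prems(3)] empty.prems(3)
      unfolding right_mult_se_12 right_mult_se_21 by simp
  next
    case (insert l A)
    have l: "l + 3 \<in> {3..m}" "l + 3 \<in> {1..m}" "1 \<noteq> l + 3" "2 \<noteq> l + 3" and pb: "pbasis (l + 3) = e l"
      using insert.prems(1) by (auto simp: m_def pbasis_def)
    have x: "- x l \<in> I"
      using insert.prems ideal(4) by auto
    let ?q = "\<Sum>k\<in>A. scale (x k) (e k)" and ?r = "scale (x l) (e l)"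
    have split: "(\<Sum>k\<in>insert l A. scale (x k) (e k)) = ?r + ?q"
      using insert.hyps by simp
    \<comment> \<open>the cocycle in \<open>rho_comp\<close> and \<open>mu_comp\<close> is compensated in the scalar of the remaining factor\<close>
    have "\<alpha> + B ?q ?r \<in> I"
      using insert.prems by (intro ideal(2) B_I) auto
    then have IH: "rho scale B ?q (\<alpha> + B ?q ?r) \<in> ?S" "mu scale B ?q (\<alpha> + B ?q ?r) \<in> ?S"
      using insert.IH insert.prems by simp_all
    have "rho scale B ?r 0 \<in> ?S" "mu scale B ?r 0 \<in> ?S"
      using gen[OF m_range(1) l(2,3) x] gen[OF m_range(2) l(2,4) x]
      unfolding right_mult_se_1[OF l(1)] right_mult_se_2[OF l(1)] pb by simp_all
    from comp[OF this(1) IH(1)] comp[OF this(2) IH(2)] show ?case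
      by (simp add: rho_comp mu_comp split)
  qed
  have "rho scale B q \<alpha> \<in> ?S \<and> mu scale B q \<alpha> \<in> ?S" if "q \<in> ideal_times scale I" "\<alpha> \<in> I" for q \<alpha>
    using sum[of "{..<2 * n}" "\<lambda>k. coords q $ k" \<alpha>] coords_ideal_times[OF I that(1)] that(2)
    by (simp add: coords_expansion)
  then show ?thesis
    unfolding ETrans_def
    by (intro group.generate_subgroup_incl[OF group_BijGroup _ act_ESp_subgroup]) blast
qed

text \<open>
  The absolute groups agree over \<open>R\<close>, so both normal closures are taken in the same group. Over \<open>I\<close>,
  \<open>ESp(I)\<close> may be larger than \<open>ETrans(IQ)\<close>, but it lies in the normal closure of the latter.
\<close>

lemma act_ESp_rel:
  assumes I: "Modules.module.subspace (*) I" and h: "2 * h = (1 :: 'a)"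
  shows "act ` ESp_rel m I = ETrans_rel scale B I"
proof -
  let ?G = "BijGroup (UNIV :: ('a \<times> 'a \<times> 'p) set)" and ?E = "ETrans scale B"
  have "?E UNIV \<lhd> ?G\<lparr>carrier := ?E UNIV\<rparr>"
    using group.normal_self[OF subgroup.subgroup_is_group[OF ETrans_subgroup group_BijGroup]] by simp
  then have eq: "act ` ESp m UNIV = ?E UNIV"
    using act_ESp_subset_normal[OF UNIV_ideal h] ETrans_subset_act_ESp[OF UNIV_ideal] by blast
  have "act ` ESp_rel m I = normal_closure ?G (act ` ESp m UNIV) (act ` ESp m I)"
    unfolding ESp_rel_def
    by (rule group_hom.image_normal_closure[OF act_hom ESp_subgroup ESp_mono]) simp
  also have "\<dots> = normal_closure ?G (?E UNIV) (act ` ESp m I)"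
    by (simp only: eq)
  also have "\<dots> = normal_closure ?G (?E UNIV) (?E I)"
  proof (rule normal_closure_eqI[symmetric])
    show "?E I \<subseteq> act ` ESp m I"
      by (rule ETrans_subset_act_ESp[OF I])
    show "act ` ESp m I \<subseteq> normal_closure ?G (?E UNIV) (?E I)"
      by (intro act_ESp_subset_normal[OF I h] normal_closure_normal group_BijGroup ETrans_subgroup
          ETrans_mono subset_normal_closure) simp
  qed
  finally show ?thesis
    by (simp add: ETrans_rel_def)
qed

text \<open>
  The matrix of \<open>act M\<close> is the inverse of \<open>M\<close>, and a subgroup is closed under inverses.
\<close>

lemma matrix_Q_ETrans_rel:
  assumes I: "Modules.module.subspace (*) I" and h: "2 * h = (1 :: 'a)"
  shows "matrix_Q scale (2 * n) e ` ETrans_rel scale B I = ESp_rel m I"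
proof -
  interpret GL: group "GL m :: 'a mat monoid"
    by (rule group_GL)
  have sg: "subgroup (ESp_rel m I) (GL m)"
    unfolding ESp_rel_def by (intro normal_closure_subgroup group_GL ESp_subgroup ESp_mono) simp
  have "matrix_Q scale (2 * n) e (act M) = inv\<^bsub>GL m\<^esub> M" if "M \<in> ESp_rel m I" for M
    unfolding act_def
    using GL_carrier[OF GL.inv_closed[OF subgroup.mem_carrier[OF sg that]]] by (rule matrix_Q_right_mult)
  then have "matrix_Q scale (2 * n) e ` act ` ESp_rel m I = (\<lambda>M. inv\<^bsub>GL m\<^esub> M) ` ESp_rel m I"
    by (simp add: image_image)
  also have "\<dots> = ESp_rel m I"
  proof
    show "(\<lambda>M. inv\<^bsub>GL m\<^esub> M) ` ESp_rel m I \<subseteq> ESp_rel m I"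
      using subgroup.m_inv_closed[OF sg] by blast
    show "ESp_rel m I \<subseteq> (\<lambda>M. inv\<^bsub>GL m\<^esub> M) ` ESp_rel m I"
      using subgroup.m_inv_closed[OF sg] GL.inv_inv[OF subgroup.mem_carrier[OF sg]] by force
  qed
  finally show ?thesis
    by (simp only: act_ESp_rel[OF I h])
qed

end

theorem lemma5p14:
  fixes scale :: "'a::comm_ring_1 \<Rightarrow> 'p::ab_group_add \<Rightarrow> 'p"
    and e :: "nat \<Rightarrow> 'p"
    and B :: "'p \<Rightarrow> 'p \<Rightarrow> 'a"
    and I :: "'a set"
    and n :: nat
  assumes two: "(UNIV :: 'a set) = range (\<lambda>r. 2 * r)"
    and I: "Modules.module.subspace (*) I"
    and P: "Modules.module scale"
    and n: "n \<ge> 1"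
    and basis: "is_basis scale (2 * n) e"
    and B: "\<And>p q. B p q = matrix_form (psi n) (coords_P scale (2 * n) e p) (coords_P scale (2 * n) e q)"
  shows "matrix_Q scale (2 * n) e ` ETrans_rel scale B I = ESp_rel (2 * n + 2) I"
proof -
  interpret symplectic_basis scale B n e
    by (intro symplectic_basis.intro symplectic_basis_axioms.intro P basis B)
  obtain h :: 'a where "2 * h = 1"
    using two by (metis UNIV_I imageE)
  then show ?thesis
    using matrix_Q_ETrans_rel[OF I] by (simp add: m_def)
qed

end
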